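(* Let $n\ge2$ be a natural number and consider the subgroup $\mathbb{Z}/n\mathbb{Z}\subset\mathrm{Diff}^{\omega,\delta}_+S^1$ generated by the $1/n$-rotation of $S^1$. Let $k$ be a positive integer and assume that the homomorphism $$H_{2k-1}(\mathbb{Z}/n\mathbb{Z};\mathbb{Z})\cong\mathbb{Z}/n\mathbb{Z}\rightarrow H_{2k-1}(B\mathrm{Diff}^{\omega,\delta}_+S^1;\mathbb{Z})$$ induced by the inclusion is trivial. Then $$\chi^k\neq0\in H^{2k}(B\mathrm{Diff}^{\omega,\delta}_+S^1;\mathbb{Q}).$$
   Context: $\mathrm{Diff}^{\omega,\delta}_+S^1$ is the group of orientation preserving real analytic diffeomorphisms of $S^1=\mathbb{R}/\mathbb{Z}$, with the discrete topology; (co)homology of its classifying space is (co)homology of the abstract group. The $1/n$-rotation is $x\mapsto x+1/n$. $\chi\in H^2(B\mathrm{Diff}^{\omega,\delta}_+S^1;\mathbb{Q})$ is the rational Euler class of the universal real analytic flat $S^1$-bundle, i.e. the rational class of the central extension $0\to\mathbb{Z}\to\{f\in\mathrm{Diff}^\omega_+\mathbb{R}: fT=Tf\}\to\mathrm{Diff}^\omega_+S^1\to1$, where $T(x)=x+1$ generates the kernel. *)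

theory Defs
  imports "HOL-Analysis.Analysis" "HOL-Algebra.Free_Abelian_Groups"
begin

section \<open>Group homology and cohomology via the inhomogeneous bar complex\<close>

definition bar_simplices :: "('g, 'r) monoid_scheme \<Rightarrow> nat \<Rightarrow> 'g list set" where
  "bar_simplices G n = {gs. length gs = n \<and> set gs \<subseteq> carrier G}"

definition bar_face :: "('g, 'r) monoid_scheme \<Rightarrow> nat \<Rightarrow> 'g list \<Rightarrow> 'g list" where
  "bar_face G i gs =
     (if i = 0 then tl gs
      else if i = length gs then butlast gs
      else take (i - 1) gs @ [gs ! (i - 1) \<otimes>\<^bsub>G\<^esub> gs ! i] @ drop (i + 1) gs)"

definition bar_chains :: "('g, 'r) monoid_scheme \<Rightarrow> nat \<Rightarrow> ('g list \<Rightarrow>\<^sub>0 int) monoid" where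
  "bar_chains G n = free_Abelian_group (bar_simplices G n)"

text \<open>The boundary vanishes in degree 0; the alternating sum alone would not, since
  \<^term>\<open>bar_face G 0 [] = []\<close>.\<close>

definition bar_boundary ::
    "('g, 'r) monoid_scheme \<Rightarrow> ('g list \<Rightarrow>\<^sub>0 int) \<Rightarrow> ('g list \<Rightarrow>\<^sub>0 int)" where
  "bar_boundary G = frag_extend (\<lambda>gs.
     if gs = [] then 0
     else (\<Sum>i\<le>length gs. frag_cmul ((-1) ^ i) (frag_of (bar_face G i gs))))"

definition bar_cycles :: "('g, 'r) monoid_scheme \<Rightarrow> nat \<Rightarrow> ('g list \<Rightarrow>\<^sub>0 int) set" where
  "bar_cycles G n = {c \<in> carrier (bar_chains G n). bar_boundary G c = 0}"

definition bar_boundaries :: "('g, 'r) monoid_scheme \<Rightarrow> nat \<Rightarrow> ('g list \<Rightarrow>\<^sub>0 int) set" where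
  "bar_boundaries G n = bar_boundary G ` carrier (bar_chains G (n + 1))"

definition group_homology ::
    "('g, 'r) monoid_scheme \<Rightarrow> nat \<Rightarrow> ('g list \<Rightarrow>\<^sub>0 int) set monoid" where
  "group_homology G n = (bar_chains G n)\<lparr>carrier := bar_cycles G n\<rparr> Mod bar_boundaries G n"

text \<open>The map induced on homology by a homomorphism \<open>u\<close> from \<open>H\<close> to \<open>G\<close>. The union runs
  over the representatives of a class; it is a union of copies of one and the same coset.\<close>

definition group_homology_induced ::
    "('g, 'r) monoid_scheme \<Rightarrow> ('h \<Rightarrow> 'g) \<Rightarrow> nat \<Rightarrow>
     ('h list \<Rightarrow>\<^sub>0 int) set \<Rightarrow> ('g list \<Rightarrow>\<^sub>0 int) set" where
  "group_homology_induced G u n X =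
     (\<Union>c\<in>X. bar_boundaries G n #>\<^bsub>bar_chains G n\<^esub> frag_extend (\<lambda>gs. frag_of (map u gs)) c)"

text \<open>Cochains are functions on \<^term>\<open>bar_simplices G n\<close>, extended by zero.\<close>

definition bar_cochains ::
    "('g, 'r) monoid_scheme \<Rightarrow> nat \<Rightarrow> ('g list \<Rightarrow> 'a::comm_ring_1) monoid" where
  "bar_cochains G n =
     \<lparr>carrier = {f. \<forall>gs. gs \<notin> bar_simplices G n \<longrightarrow> f gs = 0},
      monoid.mult = (\<lambda>f g gs. f gs + g gs),
      one = (\<lambda>_. 0)\<rparr>"

definition bar_coboundary ::
    "('g, 'r) monoid_scheme \<Rightarrow> nat \<Rightarrow> ('g list \<Rightarrow> 'a::comm_ring_1) \<Rightarrow> 'g list \<Rightarrow> 'a" where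
  "bar_coboundary G n f gs =
     (if gs \<in> bar_simplices G (n + 1) then (\<Sum>i\<le>n + 1. (-1) ^ i * f (bar_face G i gs)) else 0)"

definition bar_cocycles ::
    "('g, 'r) monoid_scheme \<Rightarrow> nat \<Rightarrow> ('g list \<Rightarrow> 'a::comm_ring_1) set" where
  "bar_cocycles G n = {f \<in> carrier (bar_cochains G n). bar_coboundary G n f = (\<lambda>_. 0)}"

definition bar_coboundaries ::
    "('g, 'r) monoid_scheme \<Rightarrow> nat \<Rightarrow> ('g list \<Rightarrow> 'a::comm_ring_1) set" where
  "bar_coboundaries G n =
     (if n = 0 then {\<lambda>_. 0} else bar_coboundary G (n - 1) ` carrier (bar_cochains G (n - 1)))"

definition group_cohomology ::
    "('g, 'r) monoid_scheme \<Rightarrow> nat \<Rightarrow> ('g list \<Rightarrow> 'a::comm_ring_1) set monoid" where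
  "group_cohomology G n = (bar_cochains G n)\<lparr>carrier := bar_cocycles G n\<rparr> Mod bar_coboundaries G n"

definition cohomology_class ::
    "('g, 'r) monoid_scheme \<Rightarrow> nat \<Rightarrow> ('g list \<Rightarrow> 'a::comm_ring_1) \<Rightarrow> ('g list \<Rightarrow> 'a) set" where
  "cohomology_class G n f = bar_coboundaries G n #>\<^bsub>bar_cochains G n\<^esub> f"

definition cochain_cup ::
    "nat \<Rightarrow> ('g list \<Rightarrow> 'a::comm_ring_1) \<Rightarrow> ('g list \<Rightarrow> 'a) \<Rightarrow> 'g list \<Rightarrow> 'a" where
  "cochain_cup p f g gs = f (take p gs) * g (drop p gs)"

text \<open>The cup product on classes of degrees \<open>p\<close> and \<open>q\<close>; again all the cosets in the union
  coincide.\<close>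

definition cup_product ::
    "('g, 'r) monoid_scheme \<Rightarrow> nat \<Rightarrow> nat \<Rightarrow>
     ('g list \<Rightarrow> 'a::comm_ring_1) set \<Rightarrow> ('g list \<Rightarrow> 'a) set \<Rightarrow> ('g list \<Rightarrow> 'a) set" where
  "cup_product G p q X Y = (\<Union>f\<in>X. \<Union>g\<in>Y. cohomology_class G (p + q) (cochain_cup p f g))"

primrec cup_power ::
    "('g, 'r) monoid_scheme \<Rightarrow> nat \<Rightarrow> ('g list \<Rightarrow> 'a::comm_ring_1) set \<Rightarrow> nat \<Rightarrow> ('g list \<Rightarrow> 'a) set"
  where
  "cup_power G d X 0 = cohomology_class G 0 (\<lambda>gs. if gs = [] then 1 else 0)"
| "cup_power G d X (Suc k) = cup_product G (d * k) d (cup_power G d X k) X"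

text \<open>For a central extension of \<open>G\<close> by the integers, with \<open>i\<close> from the integers to \<open>E\<close> and \<open>p\<close>
  from \<open>E\<close> onto \<open>G\<close>, the 2-cocycle \<open>(g, h) \<mapsto> i\<^sup>-\<^sup>1 (s g \<otimes> s h \<otimes> inv s (g \<otimes> h))\<close> of the set-theoretic
  section \<open>s = inv_into (carrier E) p\<close>, and its class with coefficients in \<open>'a\<close> (the class does
  not depend on the section).\<close>

definition extension_cocycle ::
    "('e, 's) monoid_scheme \<Rightarrow> ('g, 'r) monoid_scheme \<Rightarrow> (int \<Rightarrow> 'e) \<Rightarrow> ('e \<Rightarrow> 'g) \<Rightarrow> 'g list \<Rightarrow> int"
  where
  "extension_cocycle E G i p gs =
     (if gs \<in> bar_simplices G 2
      then let s = inv_into (carrier E) p; g = gs ! 0; h = gs ! 1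
           in inv_into UNIV i (s g \<otimes>\<^bsub>E\<^esub> s h \<otimes>\<^bsub>E\<^esub> inv\<^bsub>E\<^esub> s (g \<otimes>\<^bsub>G\<^esub> h))
      else 0)"

definition extension_class ::
    "('e, 's) monoid_scheme \<Rightarrow> ('g, 'r) monoid_scheme \<Rightarrow> (int \<Rightarrow> 'e) \<Rightarrow> ('e \<Rightarrow> 'g) \<Rightarrow>
     ('g list \<Rightarrow> 'a::comm_ring_1) set" where
  "extension_class E G i p = cohomology_class G 2 (\<lambda>gs. of_int (extension_cocycle E G i p gs))"


section \<open>The circle and its real analytic diffeomorphisms\<close>

quotient_type circle = real / "\<lambda>x y. x - y \<in> \<int>"
proof (rule equivpI)
  show "reflp (\<lambda>x y::real. x - y \<in> \<int>)"
    by (simp add: reflp_def)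
  show "symp (\<lambda>x y::real. x - y \<in> \<int>)"
    by (metis (no_types, lifting) Ints_minus minus_diff_eq sympI)
  show "transp (\<lambda>x y::real. x - y \<in> \<int>)"
  proof (rule transpI)
    fix x y z :: real
    assume "x - y \<in> \<int>" "y - z \<in> \<int>"
    then have "(x - y) + (y - z) \<in> \<int>" by (rule Ints_add)
    then show "x - z \<in> \<int>" by simp
  qed
qed

lift_definition rotation :: "real \<Rightarrow> circle \<Rightarrow> circle" is "\<lambda>t x. x + t"
  by simp

definition real_analytic_at :: "(real \<Rightarrow> real) \<Rightarrow> real \<Rightarrow> bool" where
  "real_analytic_at f x \<longleftrightarrow> (\<exists>A. (\<lambda>t. f (x + t)) has_fps_expansion A)"

text \<open>\<open>h\<close> is the expression of \<open>f\<close> near \<open>x\<close> in charts of the circle.\<close>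

definition local_lift_at :: "(circle \<Rightarrow> circle) \<Rightarrow> (real \<Rightarrow> real) \<Rightarrow> real \<Rightarrow> bool" where
  "local_lift_at f h x \<longleftrightarrow> (\<forall>\<^sub>F y in nhds x. f (abs_circle y) = abs_circle (h y))"

definition circle_analytic :: "(circle \<Rightarrow> circle) \<Rightarrow> bool" where
  "circle_analytic f \<longleftrightarrow> (\<forall>x. \<exists>h. real_analytic_at h x \<and> local_lift_at f h x)"

definition circle_orientation_preserving :: "(circle \<Rightarrow> circle) \<Rightarrow> bool" where
  "circle_orientation_preserving f \<longleftrightarrow>
     (\<forall>x. \<exists>h. real_analytic_at h x \<and> local_lift_at f h x \<and> deriv h x > 0)"

definition Diff_circle :: "(circle \<Rightarrow> circle) monoid" where
  "Diff_circle =
     \<lparr>carrier = {f. bij f \<and> circle_analytic f \<and> circle_analytic (inv_into UNIV f) \<and>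
                    circle_orientation_preserving f},
      monoid.mult = (\<circ>),
      one = id\<rparr>"

definition translation :: "int \<Rightarrow> real \<Rightarrow> real" where
  "translation m x = x + of_int m"

definition Diff_line_periodic :: "(real \<Rightarrow> real) monoid" where
  "Diff_line_periodic =
     \<lparr>carrier = {f. bij f \<and> (\<forall>x. real_analytic_at f x) \<and> (\<forall>x. real_analytic_at (inv_into UNIV f) x) \<and>
                    (\<forall>x. deriv f x > 0) \<and> f \<circ> translation 1 = translation 1 \<circ> f},
      monoid.mult = (\<circ>),
      one = id\<rparr>"

definition descend :: "(real \<Rightarrow> real) \<Rightarrow> circle \<Rightarrow> circle" where
  "descend f = map_fun rep_circle abs_circle f"

lemma abs_circle_eq_iff: "abs_circle x = abs_circle y \<longleftrightarrow> x - y \<in> \<int>"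
  using Quotient3_rel_abs[OF Quotient3_circle] circle.abs_eq_iff by blast

lemma periodic_translation:
  assumes "f \<circ> translation 1 = translation 1 \<circ> f"
  shows "f (x + of_int m) = f x + of_int m"
proof -
  have step: "f (y + 1) = f y + 1" for y
    using fun_cong[OF assms, of y] by (simp add: translation_def)
  have up: "f (y + real k) = f y + real k" for y k
  proof (induction k)
    case (Suc k)
    then show ?case using step[of "y + real k"] by (simp add: algebra_simps)
  qed simp
  show ?thesis
  proof (cases "m \<ge> 0")
    case True
    then show ?thesis using up[of x "nat m"] by simp
  next
    case False
    then show ?thesis using up[of "x + of_int m" "nat (- m)"] by simp
  qed
qed

lemma descend_abs_circle:
  assumes "f \<circ> translation 1 = translation 1 \<circ> f"
  shows "descend f (abs_circle x) = abs_circle (f x)"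
proof -
  have "abs_circle (rep_circle (abs_circle x)) = abs_circle x"
    by (rule Quotient3_abs_rep[OF Quotient3_circle])
  then obtain m where "rep_circle (abs_circle x) = x + of_int m"
    by (metis abs_circle_eq_iff Ints_cases add_diff_cancel_left' add.commute diff_add_cancel)
  then show ?thesis
    by (simp add: descend_def abs_circle_eq_iff periodic_translation[OF assms])
qed

definition euler_class :: "((circle \<Rightarrow> circle) list \<Rightarrow> rat) set" where
  "euler_class = extension_class Diff_line_periodic Diff_circle translation descend"

end

theory Submission
  imports Defs "HOL-Number_Theory.Cong"
begin

text \<open>
  Let \<open>r\<close> be the rotation by \<open>1/n\<close> and \<open>H\<close> the group that it generates. In the bar complex of \<open>H\<close>
  the sum \<open>z\<close> of all \<open>[r|j\<^sub>1|r|\<dots>|j\<^bsub>k-1\<^esub>|r]\<close> is a cycle, and the boundary of the sum \<open>w\<close> of all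
  \<open>[r|j\<^sub>1|r|\<dots>|r|j\<^sub>k]\<close> is \<open>n z\<close>. If \<open>z\<close> bounds a chain \<open>d\<close> of the whole group and the \<open>k\<close>-th power
  of the Euler cocycle \<open>e\<close> is the coboundary of a rational cochain \<open>u\<close>, then \<open>u(z) = e\<^sup>k(d)\<close> is an
  integer, so that \<open>n\<close> divides \<open>n u(z) = e\<^sup>k(w) = (\<Sum>\<^sub>j e(r,j))\<^sup>k\<close>. But the section lifts \<open>r\<close> to a
  translation by some \<open>1/n + m\<close>, and the sum telescopes to \<open>n (1/n + m)\<close>, which is \<open>1\<close> modulo \<open>n\<close>.
\<close>

section \<open>Chains, cochains and cup powers\<close>

text \<open>The Kronecker pairing of cochains with integral chains. The coefficients of the cochain
  are left general, since a rational cochain \<open>u\<close> has to be paired with integral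
  chains.\<close>

definition frag_eval :: "('x \<Rightarrow> 'a::comm_ring_1) \<Rightarrow> ('x \<Rightarrow>\<^sub>0 int) \<Rightarrow> 'a" where
  "frag_eval f c = (\<Sum>x\<in>Poly_Mapping.keys c. of_int (Poly_Mapping.lookup c x) * f x)"

lemma frag_eval_superset:
  assumes "finite S" "Poly_Mapping.keys c \<subseteq> S"
  shows "frag_eval f c = (\<Sum>x\<in>S. of_int (Poly_Mapping.lookup c x) * f x)"
  unfolding frag_eval_def using assms
  by (intro sum.mono_neutral_left) (auto simp: in_keys_iff)

lemma frag_eval_0 [simp]: "frag_eval f 0 = 0"
  by (simp add: frag_eval_def)

lemma frag_eval_frag_of [simp]: "frag_eval f (frag_of x) = f x"
  by (simp add: frag_eval_def)

lemma frag_eval_diff: "frag_eval f (a - b) = frag_eval f a - frag_eval f b"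
proof -
  let ?S = "Poly_Mapping.keys a \<union> Poly_Mapping.keys b"
  have "Poly_Mapping.keys (a - b) \<subseteq> ?S" by (rule keys_diff)
  then show ?thesis
    by (simp add: frag_eval_superset[of ?S] lookup_minus left_diff_distrib sum_subtractf)
qed

lemma frag_eval_add: "frag_eval f (a + b) = frag_eval f a + frag_eval f b"
  using frag_eval_diff[of f a "0 - b"] frag_eval_diff[of f 0 b] by simp

lemma frag_eval_sum: "frag_eval f (\<Sum>i\<in>I. c i) = (\<Sum>i\<in>I. frag_eval f (c i))"
  by (induction I rule: infinite_finite_induct) (auto simp: frag_eval_add)

lemma frag_eval_cmul: "frag_eval f (frag_cmul m c) = of_int m * frag_eval f c"
proof -
  have "Poly_Mapping.keys (frag_cmul m c) \<subseteq> Poly_Mapping.keys c" by (rule keys_cmul)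
  then have "frag_eval f (frag_cmul m c)
      = (\<Sum>x\<in>Poly_Mapping.keys c. of_int (Poly_Mapping.lookup (frag_cmul m c) x) * f x)"
    by (intro frag_eval_superset) auto
  then show ?thesis
    by (simp add: frag_eval_def sum_distrib_left mult.assoc)
qed

text \<open>The source of all integrality below: chains have integer coefficients, so integer-valued
  cochains pair to integers, whatever the ring they live in.\<close>

lemma frag_eval_Ints:
  assumes "\<And>x. f x \<in> \<int>"
  shows "frag_eval f c \<in> \<int>"
  unfolding frag_eval_def using assms by (intro Ints_sum Ints_mult) auto

lemma bar_boundary_diff: "bar_boundary G (a - b) = bar_boundary G a - bar_boundary G b"
  by (simp add: bar_boundary_def frag_extend_diff)

lemma bar_boundary_0 [simp]: "bar_boundary G 0 = 0"
  by (simp add: bar_boundary_def)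

lemma bar_boundary_frag_of:
  "gs \<noteq> [] \<Longrightarrow> bar_boundary G (frag_of gs)
     = (\<Sum>i\<le>length gs. frag_cmul ((-1) ^ i) (frag_of (bar_face G i gs)))"
  by (simp add: bar_boundary_def)

lemma bar_boundary_sum: "bar_boundary G (\<Sum>i\<in>I. c i) = (\<Sum>i\<in>I. bar_boundary G (c i))"
proof (cases "finite I")
  case True
  then show ?thesis by (simp add: bar_boundary_def frag_extend_sum o_def)
qed simp

text \<open>Duality of boundary and coboundary. On one simplex of degree \<open>m + 1\<close> both
  sides are the same alternating sum over faces, and both are additive in \<open>c\<close>.\<close>

lemma frag_eval_bar_boundary:
  assumes "c \<in> carrier (bar_chains G (m + 1))"
  shows "frag_eval f (bar_boundary G c) = frag_eval (bar_coboundary G m f) c"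
proof -
  have "Poly_Mapping.keys c \<subseteq> bar_simplices G (m + 1)"
    using assms by (simp add: bar_chains_def)
  then show ?thesis
  proof (induction c rule: frag_induction)
    case (one x)
    then have "length x = m + 1" by (simp add: bar_simplices_def)
    with one show ?case
      by (subst bar_boundary_frag_of)
         (auto simp: bar_coboundary_def frag_eval_sum frag_eval_cmul frag_eval_add)
  qed (auto simp: bar_boundary_diff frag_eval_diff)
qed

section \<open>Representatives of cup powers, and the meaning of a trivial class\<close>

primrec cochain_power :: "nat \<Rightarrow> ('g list \<Rightarrow> 'a::comm_ring_1) \<Rightarrow> nat \<Rightarrow> 'g list \<Rightarrow> 'a" where
  "cochain_power d f 0 = (\<lambda>gs. if gs = [] then 1 else 0)"
| "cochain_power d f (Suc k) = cochain_cup (d * k) (cochain_power d f k) f"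

lemma zero_in_bar_coboundaries: "(\<lambda>_. 0) \<in> bar_coboundaries G n"
  unfolding bar_coboundaries_def
  by (auto intro!: image_eqI[of _ _ "\<lambda>_. 0"] simp: bar_cochains_def bar_coboundary_def fun_eq_iff)

lemma mem_cohomology_class: "f \<in> cohomology_class G n f"
  unfolding cohomology_class_def r_coset_def
  using zero_in_bar_coboundaries[of G n] by (force simp: bar_cochains_def)

text \<open>\<open>cup_product\<close> is a union over all representatives; taking the same
  \<open>f\<close> in every factor singles out one explicit cochain of that union.\<close>

lemma cochain_power_mem_cup_power:
  assumes "f \<in> X"
  shows "cochain_power d f k \<in> cup_power G d X k"
proof (induction k)
  case 0
  show ?case using mem_cohomology_class by auto
next
  case (Suc k)
  have "cochain_cup (d * k) (cochain_power d f k) f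
      \<in> cohomology_class G (d * k + d) (cochain_cup (d * k) (cochain_power d f k) f)"
    by (rule mem_cohomology_class)
  with Suc assms show ?case unfolding cup_power.simps cup_product_def cochain_power.simps by blast
qed

lemma cochain_power_Ints:
  assumes "\<And>gs. f gs \<in> \<int>"
  shows "cochain_power d f k gs \<in> \<int>"
  by (induction k arbitrary: gs) (auto simp: cochain_cup_def assms intro!: Ints_mult)

text \<open>The unit of a quotient group is the subgroup divided out, here the set of coboundaries,
  and it contains the representative. Positive degree selects the second case of
  \<open>bar_coboundaries\<close>.\<close>

lemma cup_power_eq_one_imp_coboundary:
  assumes "f \<in> X" "d * k > 0" "cup_power G d X k = \<one>\<^bsub>group_cohomology G (d * k)\<^esub>"
  obtains u where "cochain_power d f k = bar_coboundary G (d * k - 1) u"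
  using cochain_power_mem_cup_power[OF assms(1), of d k G] assms(2,3)
  by (auto simp: group_cohomology_def FactGroup_def bar_coboundaries_def split: if_splits)

text \<open>The inclusion is \<open>id\<close>, so it fixes the chain \<open>z\<close>. The image of
  the class of \<open>z\<close> then contains \<open>0 + z\<close>, and by triviality that image is
  the set of boundaries.\<close>

lemma induced_trivial_imp_boundary:
  assumes "z \<in> bar_cycles H m"
    and triv: "\<forall>X \<in> carrier (group_homology H m).
           group_homology_induced G id m X = \<one>\<^bsub>group_homology G m\<^esub>"
  shows "z \<in> bar_boundaries G m"
proof -
  have zero: "0 \<in> bar_boundaries G m"
    unfolding bar_boundaries_def by (rule image_eqI[of _ _ 0]) (auto simp: bar_chains_def)
  have zeroH: "0 \<in> bar_boundaries H m"
    unfolding bar_boundaries_def by (rule image_eqI[of _ _ 0]) (auto simp: bar_chains_def)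
  let ?X = "bar_boundaries H m #>\<^bsub>(bar_chains H m)\<lparr>carrier := bar_cycles H m\<rparr>\<^esub> z"
  have "?X \<in> carrier (group_homology H m)"
    using assms(1) by (auto simp: group_homology_def FactGroup_def RCOSETS_def)
  with triv have "group_homology_induced G id m ?X = bar_boundaries G m"
    by (simp add: group_homology_def FactGroup_def)
  moreover have "z \<in> ?X"
    using zeroH by (force simp: r_coset_def bar_chains_def)
  moreover have "frag_extend (\<lambda>gs. frag_of (map id gs)) z = z"
    by (simp add: frag_expansion[symmetric])
  ultimately show ?thesis
    using zero by (force simp: group_homology_induced_def r_coset_def bar_chains_def)
qed

section \<open>Cycles of a cyclic group\<close>

definition pair_word :: "'g \<Rightarrow> 'g list \<Rightarrow> 'g list" where
  "pair_word r js = concat (map (\<lambda>j. [r, j]) js)"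

lemma pair_word_simps [simp]:
  "pair_word r [] = []" "pair_word r (j # js) = r # j # pair_word r js"
  "pair_word r (xs @ ys) = pair_word r xs @ pair_word r ys"
  by (simp_all add: pair_word_def)

lemma length_pair_word [simp]: "length (pair_word r js) = 2 * length js"
  by (induction js) auto

lemma set_pair_word: "set (pair_word r js) \<subseteq> insert r (set js)"
  by (induction js) auto

lemma bar_face_mult:
  "i = Suc (length xs) \<Longrightarrow> bar_face G i (xs @ x # y # ys) = xs @ (x \<otimes>\<^bsub>G\<^esub> y) # ys"
  by (simp add: bar_face_def nth_append)

lemma bar_face_0: "bar_face G 0 gs = tl gs"
  by (simp add: bar_face_def)

lemma bar_face_last: "gs \<noteq> [] \<Longrightarrow> i = length gs \<Longrightarrow> bar_face G i gs = butlast gs"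
  by (simp add: bar_face_def)

text \<open>Changing one entry by a bijection permutes the simplices, the inverse using
  \<open>inv_into\<close>. This makes faces cancel in the sum that differ by a factor
  \<open>r\<close> in one entry.\<close>

lemma sum_bar_simplices_update:
  assumes "bij_betw \<phi> (carrier H) (carrier H)" "i < m"
  shows "(\<Sum>js\<in>bar_simplices H m. F (js[i := \<phi> (js ! i)])) = (\<Sum>js\<in>bar_simplices H m. F js)"
proof (rule sum.reindex_bij_betw)
  let ?L = "bar_simplices H m"
  let ?\<psi> = "inv_into (carrier H) \<phi>"
  have psi: "bij_betw ?\<psi> (carrier H) (carrier H)"
    by (rule bij_betw_inv_into[OF assms(1)])
  have closed: "js[i := \<theta> (js ! i)] \<in> ?L"
    if "bij_betw \<theta> (carrier H) (carrier H)" "js \<in> ?L" for \<theta> js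
  proof -
    have "js ! i \<in> carrier H" using that assms(2) by (auto simp: bar_simplices_def)
    then have "\<theta> (js ! i) \<in> carrier H" using that(1) by (auto simp: bij_betw_def)
    then show ?thesis
      using that(2) set_update_subset_insert[of js i] by (auto simp: bar_simplices_def)
  qed
  have nth: "js ! i \<in> carrier H" if "js \<in> ?L" for js
    using that assms(2) by (auto simp: bar_simplices_def)
  show "bij_betw (\<lambda>js. js[i := \<phi> (js ! i)]) ?L ?L"
    by (rule bij_betw_byWitness[where f' = "\<lambda>js. js[i := ?\<psi> (js ! i)]"])
       (use assms closed[OF assms(1)] closed[OF psi] nth in
         \<open>auto simp: bar_simplices_def bij_betw_inv_into_left bij_betw_inv_into_right\<close>)
qed

lemma bar_simplices_Suc:
  "bar_simplices H (Suc m) = (\<lambda>(js, j). js @ [j]) ` (bar_simplices H m \<times> carrier H)"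
proof (intro equalityI subsetI)
  fix gs assume gs: "gs \<in> bar_simplices H (Suc m)"
  then have "gs \<noteq> []" by (auto simp: bar_simplices_def)
  then obtain js j where "gs = js @ [j]" by (metis rev_exhaust)
  with gs show "gs \<in> (\<lambda>(js, j). js @ [j]) ` (bar_simplices H m \<times> carrier H)"
    by (force simp: bar_simplices_def)
qed (auto simp: bar_simplices_def)

text \<open>The last entry is split off because both the unpaired last face and the last cup factor
  concern it.\<close>

lemma sum_bar_simplices_Suc:
  "(\<Sum>gs\<in>bar_simplices H (Suc m). F gs)
     = (\<Sum>js\<in>bar_simplices H m. \<Sum>j\<in>carrier H. F (js @ [j]))"
proof -
  have "inj_on (\<lambda>(js, j). js @ [j]) (bar_simplices H m \<times> carrier H)"
    by (auto simp: inj_on_def)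
  then show ?thesis
    by (simp add: bar_simplices_Suc sum.reindex sum.cartesian_product case_prod_unfold)
qed

text \<open>The axioms are what the cancellation of faces and the count of the leftover terms use:
  both translations by \<open>r\<close> permute a finite carrier.\<close>

locale cyclic_cycles =
  fixes H :: "('g, 'r) monoid_scheme" (structure) and r :: 'g
  assumes finite_carrier: "finite (carrier H)"
    and gen_closed: "r \<in> carrier H"
    and bij_left: "bij_betw (\<lambda>j. r \<otimes> j) (carrier H) (carrier H)"
    and bij_right: "bij_betw (\<lambda>j. j \<otimes> r) (carrier H) (carrier H)"
begin

abbreviation "L \<equiv> bar_simplices H"

text \<open>The common value of the faces \<open>2i\<close> and \<open>2i + 1\<close> of \<open>[r|j\<^sub>1|r|j\<^sub>2|\<dots>]\<close>, up to
  translating one entry \<open>j\<close> by \<open>r\<close>.\<close>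

definition common_face :: "'g list \<Rightarrow> nat \<Rightarrow> 'g list \<Rightarrow> 'g list" where
  "common_face t i js = pair_word r (take i js) @ tl (pair_word r (drop i js) @ t)"

text \<open>For \<open>i > 0\<close> the face \<open>2 * i\<close> multiplies the entry at position
  \<open>i - 1\<close> by the \<open>r\<close> after it, and
  \<open>j \<mapsto> j \<otimes> r\<close> is a bijection; face 0 drops the first \<open>r\<close>.
  The tail \<open>t\<close> is \<open>[r]\<close> for the cycle and \<open>[]\<close> for the
  chain.\<close>

lemma even_face_sum:
  assumes "i < m \<or> i = m \<and> t = [r]"
  shows "(\<Sum>js\<in>L m. F (bar_face H (2 * i) (pair_word r js @ t))) = (\<Sum>js\<in>L m. F (common_face t i js))"
proof (cases i)
  case 0
  then show ?thesis by (simp add: bar_face_0 common_face_def)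
next
  case (Suc l)
  have face: "bar_face H (2 * i) (pair_word r js @ t) = common_face t i (js[l := js ! l \<otimes> r])"
    if "js \<in> L m" for js
  proof -
    have len: "length js = m" using that by (simp add: bar_simplices_def)
    have lm: "l < m" using assms Suc by auto
    obtain us u vs where js: "js = us @ u # vs" "length us = l"
      using id_take_nth_drop[of l js] lm len by (metis length_take min.absorb4)
    \<comment> \<open>The letter after \<open>u\<close> is \<open>r\<close> in either case: it opens
      the next pair, or there is none, so \<open>i = m\<close> and \<open>t = [r]\<close>.\<close>
    have "\<exists>zs. pair_word r vs @ t = r # zs"
      using assms len js Suc by (cases vs) auto
    then obtain zs where zs: "pair_word r vs @ t = r # zs" by blast
    have "bar_face H (2 * i) ((pair_word r us @ [r]) @ u # r # zs)
        = (pair_word r us @ [r]) @ (u \<otimes> r) # zs"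
      using js Suc by (intro bar_face_mult) simp
    then show ?thesis
      using js Suc zs by (simp add: common_face_def list_update_append nth_append)
  qed
  have "l < m" using assms Suc by auto
  with bij_right have "(\<Sum>js\<in>L m. F (common_face t i (js[l := js ! l \<otimes> r])))
      = (\<Sum>js\<in>L m. F (common_face t i js))"
    by (rule sum_bar_simplices_update[where F = "\<lambda>js. F (common_face t i js)"])
  then show ?thesis using face by (simp cong: sum.cong)
qed

text \<open>The face \<open>2 * i + 1\<close> multiplies the entry at position \<open>i\<close> by
  the \<open>r\<close> before it, again a bijection of that entry. If \<open>i = m\<close>, it is
  the last face and drops the final \<open>r\<close>.\<close>

lemma odd_face_sum:
  assumes "i < m \<or> i = m \<and> t = [r]"
  shows "(\<Sum>js\<in>L m. F (bar_face H (Suc (2 * i)) (pair_word r js @ t)))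
    = (\<Sum>js\<in>L m. F (common_face t i js))"
proof (cases "i < m")
  case False
  then have "i = m" "t = [r]" using assms by auto
  then show ?thesis
    by (intro sum.cong) (auto simp: bar_simplices_def common_face_def bar_face_last)
next
  case True
  have face: "bar_face H (Suc (2 * i)) (pair_word r js @ t) = common_face t i (js[i := r \<otimes> js ! i])"
    if "js \<in> L m" for js
  proof -
    have len: "length js = m" using that by (simp add: bar_simplices_def)
    obtain us v vs where js: "js = us @ v # vs" "length us = i"
      using id_take_nth_drop[of i js] True len by (metis length_take min.absorb4)
    have "bar_face H (Suc (2 * i)) (pair_word r us @ r # v # pair_word r vs @ t)
        = pair_word r us @ (r \<otimes> v) # pair_word r vs @ t"
      using js by (intro bar_face_mult) simp
    then show ?thesis using js by (simp add: common_face_def list_update_append nth_append)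
  qed
  from bij_left True have "(\<Sum>js\<in>L m. F (common_face t i (js[i := r \<otimes> js ! i])))
      = (\<Sum>js\<in>L m. F (common_face t i js))"
    by (rule sum_bar_simplices_update[where F = "\<lambda>js. F (common_face t i js)"])
  then show ?thesis using face by (simp cong: sum.cong)
qed

text \<open>The cycle \<open>z\<close> of the outline, in degree \<open>2 * m + 1\<close>;
  \<open>cyclic_chain\<close> below gives \<open>w\<close>.\<close>

definition cyclic_cycle :: "nat \<Rightarrow> 'g list \<Rightarrow>\<^sub>0 int" where
  "cyclic_cycle m = (\<Sum>js\<in>L m. frag_of (pair_word r js @ [r]))"

definition cyclic_chain :: "nat \<Rightarrow> 'g list \<Rightarrow>\<^sub>0 int" where
  "cyclic_chain m = (\<Sum>js\<in>L m. frag_of (pair_word r js))"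

text \<open>Faces \<open>2 * i\<close> and \<open>2 * i + 1\<close> have equal sums and opposite
  signs; \<open>N\<close> counts the cancelling pairs.\<close>

lemma alternating_face_sum:
  assumes "N \<le> m \<or> N = Suc m \<and> t = [r]"
  shows "(\<Sum>i<2 * N. \<Sum>js\<in>L m.
            frag_cmul ((-1) ^ i) (frag_of (bar_face H i (pair_word r js @ t)))) = 0"
  using assms
proof (induction N)
  case (Suc N)
  from Suc.prems have N: "N < m \<or> N = m \<and> t = [r]" by auto
  have "(\<Sum>js\<in>L m. frag_cmul ((-1) ^ (2 * N)) (frag_of (bar_face H (2 * N) (pair_word r js @ t))))
      + (\<Sum>js\<in>L m. frag_cmul ((-1) ^ Suc (2 * N)) (frag_of (bar_face H (Suc (2 * N)) (pair_word r js @ t)))) = 0"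
    using even_face_sum[OF N, of frag_of] odd_face_sum[OF N, of frag_of]
    by (simp add: sum_negf)
  moreover have "(\<Sum>i<2 * N. \<Sum>js\<in>L m.
            frag_cmul ((-1) ^ i) (frag_of (bar_face H i (pair_word r js @ t)))) = 0"
    using N by (intro Suc.IH) auto
  ultimately show ?case by (simp only: mult_Suc_right add_2_eq_Suc sum.lessThan_Suc add_0)
qed simp

text \<open>Words of length \<open>2 * m + 1\<close> have \<open>2 * (m + 1)\<close> faces, so every
  face is paired.\<close>

lemma bar_boundary_cyclic_cycle: "bar_boundary H (cyclic_cycle m) = 0"
proof -
  have "bar_boundary H (cyclic_cycle m) = (\<Sum>js\<in>L m. \<Sum>i<2 * Suc m.
            frag_cmul ((-1) ^ i) (frag_of (bar_face H i (pair_word r js @ [r]))))"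
    unfolding cyclic_cycle_def bar_boundary_sum
    by (intro sum.cong refl, subst bar_boundary_frag_of)
       (auto simp: bar_simplices_def lessThan_Suc_atMost)
  then show ?thesis
    using alternating_face_sum[of "Suc m" m "[r]"] by (subst (asm) sum.swap) simp
qed

text \<open>Words of length \<open>2 * m + 2\<close> have \<open>2 * m + 3\<close> faces. The
  unpaired last one has sign +1 and forgets the last entry, so each word of
  \<open>cyclic_cycle m\<close> arises once for every element of the carrier.\<close>

lemma bar_boundary_cyclic_chain:
  "bar_boundary H (cyclic_chain (Suc m)) = frag_cmul (int (card (carrier H))) (cyclic_cycle m)"
proof -
  have nonempty: "pair_word r js \<noteq> []" if "js \<in> L (Suc m)" for js
    using that by (cases js) (auto simp: bar_simplices_def)
  have "bar_boundary H (cyclic_chain (Suc m)) = (\<Sum>js\<in>L (Suc m). \<Sum>i<Suc (2 * Suc m).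
            frag_cmul ((-1) ^ i) (frag_of (bar_face H i (pair_word r js @ []))))"
    unfolding cyclic_chain_def bar_boundary_sum
  proof (intro sum.cong refl)
    fix js assume js: "js \<in> L (Suc m)"
    then have "length js = Suc m" by (simp add: bar_simplices_def)
    then show "bar_boundary H (frag_of (pair_word r js)) = (\<Sum>i<Suc (2 * Suc m).
        frag_cmul ((-1) ^ i) (frag_of (bar_face H i (pair_word r js @ []))))"
      using bar_boundary_frag_of[OF nonempty[OF js], of H]
      by (simp only: length_pair_word lessThan_Suc_atMost append_Nil2)
  qed
  also have "\<dots> = (\<Sum>js\<in>L (Suc m). frag_of (bar_face H (2 * Suc m) (pair_word r js)))"
    using alternating_face_sum[of "Suc m" "Suc m" "[]"]
    by (subst sum.swap) (simp del: mult_Suc_right)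
  also have "\<dots> = (\<Sum>js\<in>L m. \<Sum>j\<in>carrier H. frag_of (pair_word r js @ [r]))"
    unfolding sum_bar_simplices_Suc
    by (intro sum.cong refl, subst bar_face_last) (auto simp: bar_simplices_def butlast_append)
  also have "\<dots> = frag_cmul (int (card (carrier H))) (cyclic_cycle m)"
  proof -
    have const: "(\<Sum>j\<in>A. c) = frag_cmul (int (card A)) c" if "finite A"
      for A :: "'g set" and c :: "'g list \<Rightarrow>\<^sub>0 int"
      using that by (induction A rule: finite_induct) (auto simp: frag_cmul_distrib)
    show ?thesis
      by (simp add: const[OF finite_carrier] cyclic_cycle_def frag_cmul_sum)
  qed
  finally show ?thesis .
qed

lemma cyclic_cycle_in_bar_cycles: "cyclic_cycle m \<in> bar_cycles H (2 * m + 1)"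
proof -
  have "Poly_Mapping.keys (cyclic_cycle m) \<subseteq> (\<Union>js\<in>L m. {pair_word r js @ [r]})"
    unfolding cyclic_cycle_def by (rule order_trans[OF keys_sum]) auto
  also have "\<dots> \<subseteq> bar_simplices H (2 * m + 1)"
    using gen_closed set_pair_word[of r] by (fastforce simp: bar_simplices_def)
  finally show ?thesis
    by (simp add: bar_cycles_def bar_chains_def bar_boundary_cyclic_cycle)
qed

lemma cyclic_chain_in_bar_chains: "cyclic_chain m \<in> carrier (bar_chains H (2 * m))"
proof -
  have "Poly_Mapping.keys (cyclic_chain m) \<subseteq> (\<Union>js\<in>L m. {pair_word r js})"
    unfolding cyclic_chain_def by (rule order_trans[OF keys_sum]) auto
  also have "\<dots> \<subseteq> bar_simplices H (2 * m)"
    using gen_closed set_pair_word[of r] by (fastforce simp: bar_simplices_def)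
  finally show ?thesis by (simp add: bar_chains_def)
qed

text \<open>The cup power cuts a word into its pairs \<open>[r, j]\<close>. The entries
  \<open>j\<close> range independently, so the sum of products is a product of sums.\<close>

lemma frag_eval_cochain_power_cyclic_chain:
  "frag_eval (cochain_power 2 f m) (cyclic_chain m) = (\<Sum>j\<in>carrier H. f [r, j]) ^ m"
proof (induction m)
  case 0
  have "L 0 = {[]}" by (auto simp: bar_simplices_def)
  then show ?case by (simp add: cyclic_chain_def)
next
  case (Suc m)
  have "frag_eval (cochain_power 2 f (Suc m)) (cyclic_chain (Suc m))
      = (\<Sum>js\<in>L m. \<Sum>j\<in>carrier H. cochain_power 2 f m (pair_word r js) * f [r, j])"
    unfolding cyclic_chain_def frag_eval_sum sum_bar_simplices_Suc
    by (intro sum.cong refl) (auto simp: cochain_cup_def bar_simplices_def)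
  also have "\<dots> = (\<Sum>js\<in>L m. cochain_power 2 f m (pair_word r js)) * (\<Sum>j\<in>carrier H. f [r, j])"
    by (simp add: sum_product)
  also have "(\<Sum>js\<in>L m. cochain_power 2 f m (pair_word r js)) = (\<Sum>j\<in>carrier H. f [r, j]) ^ m"
    using Suc.IH by (simp add: cyclic_chain_def frag_eval_sum)
  finally show ?case by (simp add: mult.commute)
qed

end

section \<open>From trivial classes to divisibility\<close>

lemma mult_bar_face: "monoid.mult H = monoid.mult G \<Longrightarrow> bar_face H = bar_face G"
  by (simp add: bar_face_def fun_eq_iff)

text \<open>Faces involve the multiplication alone, so boundaries computed in the subgroup remain
  valid in the whole group.\<close>

lemma mult_bar_boundary:
  assumes "monoid.mult H = monoid.mult G"
  shows "bar_boundary H = bar_boundary G"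
  unfolding bar_boundary_def mult_bar_face[OF assms] ..

text \<open>\<open>cyclic_cycle m\<close> bounds an integral chain \<open>d\<close>, so
  \<open>u\<close> takes an integer value \<open>q\<close> on it. Evaluating \<open>u\<close> on the
  boundary of \<open>cyclic_chain k\<close> gives \<open>q\<close> times the order, and by duality
  the power of the sum.\<close>

lemma cup_power_eq_one_imp_dvd:
  fixes \<epsilon> :: "'g list \<Rightarrow> int" and X :: "('g list \<Rightarrow> 'a::{comm_ring_1, ring_char_0}) set"
    and G :: "('g, 'r) monoid_scheme" and H :: "('g, 'r) monoid_scheme"
  assumes H: "cyclic_cycles H r" "carrier H \<subseteq> carrier G" "monoid.mult H = monoid.mult G"
    and X: "(\<lambda>gs. of_int (\<epsilon> gs)) \<in> X" and k: "k > 0"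
    and triv: "\<forall>Y \<in> carrier (group_homology H (2 * k - 1)).
           group_homology_induced G id (2 * k - 1) Y = \<one>\<^bsub>group_homology G (2 * k - 1)\<^esub>"
    and zero: "cup_power G 2 X k = \<one>\<^bsub>group_cohomology G (2 * k)\<^esub>"
  shows "int (card (carrier H)) dvd (\<Sum>j\<in>carrier H. \<epsilon> [r, j]) ^ k"
proof -
  interpret cyclic_cycles H r by fact
  let ?e = "\<lambda>gs. of_int (\<epsilon> gs) :: 'a"
  \<comment> \<open>The cycle of degree \<open>2 * k - 1\<close> consists of \<open>k - 1\<close>
    pairs and a final \<open>r\<close>.\<close>
  obtain m where m: "k = Suc m" using k gr0_conv_Suc by blast
  have deg: "2 * k - 1 = 2 * m + 1" "2 * k = 2 * m + 1 + 1" using m by auto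
  obtain u where u: "cochain_power 2 ?e k = bar_coboundary G (2 * m + 1) u"
    using cup_power_eq_one_imp_coboundary[OF X _ zero] k unfolding deg(1) by auto
  have "cyclic_cycle m \<in> bar_boundaries G (2 * m + 1)"
    by (rule induced_trivial_imp_boundary[OF cyclic_cycle_in_bar_cycles triv[unfolded deg(1)]])
  then obtain d where d: "d \<in> carrier (bar_chains G (2 * m + 1 + 1))" "cyclic_cycle m = bar_boundary G d"
    by (auto simp: bar_boundaries_def)
  have "frag_eval u (cyclic_cycle m) = frag_eval (cochain_power 2 ?e k) d"
    unfolding d(2) u by (rule frag_eval_bar_boundary[OF d(1)])
  also have "\<dots> \<in> \<int>" by (intro frag_eval_Ints cochain_power_Ints) auto
  finally obtain q where q: "frag_eval u (cyclic_cycle m) = of_int q" by (auto elim: Ints_cases)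
  have "cyclic_chain k \<in> carrier (bar_chains G (2 * m + 1 + 1))"
    using cyclic_chain_in_bar_chains[of k] H(2)
    unfolding deg by (auto simp: bar_chains_def bar_simplices_def)
  then have "frag_eval u (bar_boundary G (cyclic_chain k))
      = frag_eval (cochain_power 2 ?e k) (cyclic_chain k)"
    unfolding u by (rule frag_eval_bar_boundary)
  moreover have "bar_boundary G (cyclic_chain k)
      = frag_cmul (int (card (carrier H))) (cyclic_cycle m)"
    using bar_boundary_cyclic_chain[of m] m mult_bar_boundary[OF H(3)] by simp
  ultimately have "of_int (int (card (carrier H)) * q) = (\<Sum>j\<in>carrier H. ?e [r, j]) ^ k"
    by (simp add: frag_eval_cmul frag_eval_cochain_power_cyclic_chain q)
  also have "\<dots> = of_int ((\<Sum>j\<in>carrier H. \<epsilon> [r, j]) ^ k)" by simp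
  finally have "int (card (carrier H)) * q = (\<Sum>j\<in>carrier H. \<epsilon> [r, j]) ^ k"
    using of_int_eq_iff by blast
  then show ?thesis by (metis dvd_triv_left)
qed

section \<open>The Euler cocycle on rotations\<close>

lemma abs_rep_circle: "abs_circle (rep_circle x) = x"
  by (rule Quotient3_abs_rep[OF Quotient3_circle])

lemma rotation_abs_circle: "rotation t (abs_circle x) = abs_circle (x + t)"
  by (rule rotation.abs_eq)

lemma circle_fun_eqI: "(\<And>x. f (abs_circle x) = g (abs_circle x)) \<Longrightarrow> f = g"
  by (metis abs_rep_circle ext)

lemma rotation_comp: "rotation s \<circ> rotation t = rotation (s + t)"
  by (rule circle_fun_eqI) (simp add: rotation_abs_circle algebra_simps)

lemma rotation_0: "rotation 0 = id"
  by (rule circle_fun_eqI) (simp add: rotation_abs_circle)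

lemma rotation_eq_iff: "rotation s = rotation t \<longleftrightarrow> s - t \<in> \<int>"
proof
  assume "rotation s = rotation t"
  then have "rotation s (abs_circle 0) = rotation t (abs_circle 0)" by simp
  then show "s - t \<in> \<int>" by (simp add: rotation_abs_circle abs_circle_eq_iff)
next
  assume "s - t \<in> \<int>"
  then show "rotation s = rotation t"
    by (intro circle_fun_eqI) (simp add: rotation_abs_circle abs_circle_eq_iff)
qed

section \<open>Rotations and translations as elements of the two groups\<close>

lemma real_analytic_at_add: "real_analytic_at (\<lambda>x. x + t) x"
proof -
  have "(\<lambda>s. s + (x + t)) has_fps_expansion (fps_X + fps_const (x + t))"
    by (intro fps_expansion_intros)
  then show ?thesis by (auto simp: real_analytic_at_def algebra_simps)
qed

lemma inverse_pair_inv: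
  assumes "f \<circ> g = id" "g \<circ> f = id"
  shows "bij f" "inv_into UNIV f = g"
  using assms o_bij[of g f] inv_unique_comp[of f g] by auto

lemma circle_analytic_rotation: "circle_analytic (rotation t)"
  unfolding circle_analytic_def
proof
  fix x
  show "\<exists>h. real_analytic_at h x \<and> local_lift_at (rotation t) h x"
    by (rule exI[of _ "\<lambda>y. y + t"])
       (simp add: real_analytic_at_add local_lift_at_def rotation_abs_circle)
qed

lemma rotation_in_Diff_circle: "rotation t \<in> carrier Diff_circle"
proof -
  have inv: "rotation t \<circ> rotation (- t) = id" "rotation (- t) \<circ> rotation t = id"
    by (simp_all add: rotation_comp rotation_0)
  have deriv: "deriv (\<lambda>y. y + t) x = 1" for x :: real
    by (rule DERIV_imp_deriv) (auto intro!: derivative_eq_intros)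
  have "\<exists>h. real_analytic_at h x \<and> local_lift_at (rotation t) h x \<and> deriv h x > 0" for x
    by (rule exI[of _ "\<lambda>y. y + t"])
       (auto simp: deriv real_analytic_at_add local_lift_at_def rotation_abs_circle)
  then show ?thesis
    by (simp add: Diff_circle_def circle_orientation_preserving_def inverse_pair_inv[OF inv]
        circle_analytic_rotation)
qed

lemma add_in_Diff_line_periodic: "(\<lambda>x. x + t) \<in> carrier Diff_line_periodic"
proof -
  have inv: "(\<lambda>x. x + t) \<circ> (\<lambda>x. x + (- t)) = id" "(\<lambda>x. x + (- t)) \<circ> (\<lambda>x. x + t) = id"
    by auto
  have "deriv (\<lambda>y. y + t) x = 1" for x :: real
    by (rule DERIV_imp_deriv) (auto intro!: derivative_eq_intros)
  moreover have "(\<lambda>x. x + t) \<circ> translation 1 = translation 1 \<circ> (\<lambda>x. x + t)"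
    by (auto simp: translation_def)
  ultimately show ?thesis
    unfolding Diff_line_periodic_def
    \<comment> \<open>The inverse must keep the form \<open>x + (- t)\<close>, to which
      \<open>real_analytic_at_add\<close> applies.\<close>
    by (simp add: inverse_pair_inv[OF inv] del: add_uminus_conv_diff)
       (blast intro: real_analytic_at_add)
qed

text \<open>\<open>m_inv\<close> is a definite description, so the opposite translation is checked
  to be an inverse, and the only one.\<close>

lemma inv_Diff_line_periodic_add: "inv\<^bsub>Diff_line_periodic\<^esub> (\<lambda>x. x + t) = (\<lambda>x. x + (- t))"
  unfolding m_inv_def
proof (rule the_equality)
  show "(\<lambda>x. x + - t) \<in> carrier Diff_line_periodic \<and>
    (\<lambda>x. x + t) \<otimes>\<^bsub>Diff_line_periodic\<^esub> (\<lambda>x. x + - t) = \<one>\<^bsub>Diff_line_periodic\<^esub> \<and>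
    (\<lambda>x. x + - t) \<otimes>\<^bsub>Diff_line_periodic\<^esub> (\<lambda>x. x + t) = \<one>\<^bsub>Diff_line_periodic\<^esub>"
    using add_in_Diff_line_periodic[of "- t"] by (auto simp: Diff_line_periodic_def)
next
  fix y assume y: "y \<in> carrier Diff_line_periodic \<and>
    (\<lambda>x. x + t) \<otimes>\<^bsub>Diff_line_periodic\<^esub> y = \<one>\<^bsub>Diff_line_periodic\<^esub> \<and>
    y \<otimes>\<^bsub>Diff_line_periodic\<^esub> (\<lambda>x. x + t) = \<one>\<^bsub>Diff_line_periodic\<^esub>"
  then have "y x + t = x" for x by (auto simp: Diff_line_periodic_def fun_eq_iff)
  then show "y = (\<lambda>x. x + (- t))" by (auto simp: algebra_simps)
qed

lemma inv_Diff_circle_rotation: "inv\<^bsub>Diff_circle\<^esub> (rotation t) = rotation (- t)"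
  unfolding m_inv_def
proof (rule the_equality)
  show "rotation (- t) \<in> carrier Diff_circle \<and>
    rotation t \<otimes>\<^bsub>Diff_circle\<^esub> rotation (- t) = \<one>\<^bsub>Diff_circle\<^esub> \<and>
    rotation (- t) \<otimes>\<^bsub>Diff_circle\<^esub> rotation t = \<one>\<^bsub>Diff_circle\<^esub>"
    using rotation_in_Diff_circle by (auto simp: Diff_circle_def rotation_comp rotation_0)
next
  fix y assume "y \<in> carrier Diff_circle \<and>
    rotation t \<otimes>\<^bsub>Diff_circle\<^esub> y = \<one>\<^bsub>Diff_circle\<^esub> \<and>
    y \<otimes>\<^bsub>Diff_circle\<^esub> rotation t = \<one>\<^bsub>Diff_circle\<^esub>"
  then have "rotation t \<circ> y = id" by (simp add: Diff_circle_def)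
  then have "rotation (- t) \<circ> (rotation t \<circ> y) = rotation (- t)" by simp
  then show "y = rotation (- t)"
    by (simp add: comp_assoc[symmetric] rotation_comp rotation_0)
qed

text \<open>The function \<open>f x - x - t\<close> is integer-valued and continuous, hence constant
  on the connected line.\<close>

lemma lift_of_rotation:
  assumes f: "f \<in> carrier Diff_line_periodic" and d: "descend f = rotation t"
  obtains m :: int where "f = (\<lambda>x. x + (t + of_int m))"
proof -
  have an: "real_analytic_at f x" for x using f by (simp add: Diff_line_periodic_def)
  have per: "f \<circ> translation 1 = translation 1 \<circ> f" using f by (simp add: Diff_line_periodic_def)
  have int: "f x - x - t \<in> \<int>" for x
    using descend_abs_circle[OF per, of x]
    by (simp add: d rotation_abs_circle abs_circle_eq_iff)
       (metis Ints_minus minus_diff_eq diff_diff_eq)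
  have cont: "isCont f x" for x
  proof -
    obtain A where "(\<lambda>s. f (x + s)) has_fps_expansion A"
      using an by (auto simp: real_analytic_at_def)
    then have "isCont (\<lambda>s. f (x + s)) 0" using has_fps_expansion_imp_continuous by blast
    then show ?thesis by (simp add: isCont_iff)
  qed
  have "continuous_on UNIV (\<lambda>x. f x - x - t)"
    using cont by (intro continuous_intros continuous_at_imp_continuous_on) auto
  then have "(\<lambda>x. f x - x - t) constant_on UNIV"
  proof (rule continuous_discrete_range_constant[OF connected_UNIV])
    fix x :: real
    \<comment> \<open>Distinct integers are at least 1 apart, which is the gap required of a
      discrete range.\<close>
    have "1 \<le> norm (f y - y - t - (f x - x - t))" if "f y - y - t \<noteq> f x - x - t" for y
    proof -
      have "f y - y - t - (f x - x - t) \<in> \<int>" by (rule Ints_diff[OF int int])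
      then show ?thesis using Ints_nonzero_abs_ge1 that by fastforce
    qed
    then show "\<exists>e>0. \<forall>y. y \<in> UNIV \<and> f y - y - t \<noteq> f x - x - t \<longrightarrow>
        e \<le> norm (f y - y - t - (f x - x - t))"
      by (intro exI[of _ 1]) auto
  qed
  then obtain c where c: "\<And>x. f x - x - t = c" by (auto simp: constant_on_def)
  with int obtain m where "c = of_int m" by (metis Ints_cases)
  with c have "f = (\<lambda>x. x + (t + of_int m))" by (auto simp: fun_eq_iff algebra_simps)
  then show thesis by (rule that)
qed

text \<open>The angle of the lift picked by the section of \<open>extension_cocycle\<close>; for a
  rotation this lift is a translation, so its value at 0 determines it.\<close>

definition rotation_lift :: "(circle \<Rightarrow> circle) \<Rightarrow> real" where
  "rotation_lift g = inv_into (carrier Diff_line_periodic) descend g 0"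

lemma section_rotation:
  "inv_into (carrier Diff_line_periodic) descend (rotation t)
     = (\<lambda>x. x + rotation_lift (rotation t))" (is ?lift)
  "rotation_lift (rotation t) - t \<in> \<int>" (is ?angle)
proof -
  have "descend (\<lambda>x. x + t) = rotation t"
  proof (rule circle_fun_eqI)
    fix x show "descend (\<lambda>x. x + t) (abs_circle x) = rotation t (abs_circle x)"
      by (subst descend_abs_circle) (auto simp: translation_def rotation_abs_circle)
  qed
  then have mem: "rotation t \<in> descend ` carrier Diff_line_periodic"
    using add_in_Diff_line_periodic[of t] by (metis imageI)
  obtain m :: int where "inv_into (carrier Diff_line_periodic) descend (rotation t) = (\<lambda>x. x + (t + of_int m))"
    using lift_of_rotation[OF inv_into_into[OF mem] f_inv_into_f[OF mem]] by blast
  then show ?lift ?angle by (auto simp: rotation_lift_def)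
qed

text \<open>Composing translations adds their angles. Over the reals the cocycle is thus the
  coboundary of \<open>rotation_lift\<close> on rotations, which makes the later sum
  telescope.\<close>

lemma extension_cocycle_rotation:
  "of_int (extension_cocycle Diff_line_periodic Diff_circle translation descend [rotation s, rotation t])
     = rotation_lift (rotation s) + rotation_lift (rotation t) - rotation_lift (rotation s \<circ> rotation t)"
proof -
  let ?l = "\<lambda>t. rotation_lift (rotation t)"
  \<comment> \<open>Each lifted angle is rewritten as its defect from the true angle, an
    integer.\<close>
  have "?l s + ?l t - ?l (s + t) = (?l s - s) + (?l t - t) - (?l (s + t) - (s + t))" by simp
  also have "\<dots> \<in> \<int>" by (intro Ints_add Ints_diff section_rotation(2))
  finally obtain m where m: "?l s + ?l t - ?l (s + t) = of_int m" by (auto elim: Ints_cases)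
  have inj: "inj translation" by (auto simp: inj_def translation_def fun_eq_iff)
  have simplex: "[rotation s, rotation t] \<in> bar_simplices Diff_circle 2"
    by (simp add: bar_simplices_def rotation_in_Diff_circle)
  have mults: "g \<otimes>\<^bsub>Diff_circle\<^esub> h = g \<circ> h" "p \<otimes>\<^bsub>Diff_line_periodic\<^esub> q = p \<circ> q" for g h p q
    by (simp_all add: Diff_circle_def Diff_line_periodic_def)
  have "(\<lambda>x. x + ?l s) \<circ> (\<lambda>x. x + ?l t) \<circ> (\<lambda>x. x + (- ?l (s + t))) = translation m"
    using m by (auto simp: translation_def fun_eq_iff)
  then have "extension_cocycle Diff_line_periodic Diff_circle translation descend
      [rotation s, rotation t] = m"
    using simplex
    by (simp add: extension_cocycle_def Let_def mults section_rotation(1) rotation_comp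
        inv_Diff_line_periodic_add inv_f_f[OF inj])
  with m show ?thesis by (simp add: rotation_comp)
qed

section \<open>The finite group generated by the rotation by \<open>1 / n\<close>\<close>

lemma carrier_generated_rotation:
  assumes "n > 0"
  shows "carrier (subgroup_generated Diff_circle {rotation (1 / real n)})
    = (\<lambda>j. rotation (real j / real n)) ` {..<n}" (is "_ = ?A")
proof -
  \<comment> \<open>Integer indices suit closure under inverses, indices below \<open>n\<close> suit
    counting; division with remainder links them, as whole turns act trivially.\<close>
  have range: "?A = range (\<lambda>j::int. rotation (of_int j / real n))"
  proof (intro equalityI subsetI)
    fix g assume "g \<in> range (\<lambda>j::int. rotation (of_int j / real n))"
    then obtain j :: int where g: "g = rotation (of_int j / real n)" by auto
    have "real_of_int j = of_int (j mod int n) + of_int (j div int n) * real n"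
      by (metis mod_div_mult_eq of_int_add of_int_mult of_int_of_nat_eq)
    then have "of_int j / real n - of_int (j mod int n) / real n = of_int (j div int n)"
      using assms by (simp add: field_simps)
    then have "g = rotation (of_int (j mod int n) / real n)"
      unfolding g rotation_eq_iff by simp
    also have "of_int (j mod int n) = real (nat (j mod int n))" using assms by simp
    finally show "g \<in> ?A"
      using assms by (intro image_eqI[of _ _ "nat (j mod int n)"]) (auto simp: nat_less_iff)
  next
    fix g assume "g \<in> ?A"
    then obtain j :: nat where "g = rotation (of_int (int j) / real n)" by auto
    then show "g \<in> range (\<lambda>j::int. rotation (of_int j / real n))" by blast
  qed
  have "generate Diff_circle {rotation (1 / real n)} = range (\<lambda>j::int. rotation (of_int j / real n))"
  proof (intro equalityI subsetI)
    fix g assume "g \<in> generate Diff_circle {rotation (1 / real n)}"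
    then show "g \<in> range (\<lambda>j::int. rotation (of_int j / real n))"
    proof induction
      case one
      show ?case by (rule range_eqI[of _ _ 0]) (simp add: rotation_0 Diff_circle_def)
    next
      case (incl h)
      then show ?case by (intro range_eqI[of _ _ 1]) simp
    next
      case (inv h)
      then show ?case by (intro range_eqI[of _ _ "-1"]) (simp add: inv_Diff_circle_rotation)
    next
      case (eng g h)
      then obtain i j :: int where "g = rotation (of_int i / real n)" "h = rotation (of_int j / real n)"
        by auto
      then show ?case
        by (intro range_eqI[of _ _ "i + j"]) (simp add: Diff_circle_def rotation_comp add_divide_distrib)
    qed
  next
    fix g assume "g \<in> range (\<lambda>j::int. rotation (of_int j / real n))"
    \<comment> \<open>A natural index can be chosen, so products of the generator suffice and
      induction applies.\<close>
    then obtain i :: nat where g: "g = rotation (real i / real n)" by (auto simp flip: range)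
    show "g \<in> generate Diff_circle {rotation (1 / real n)}"
      unfolding g
    proof (induction i)
      case 0
      have "rotation 0 = \<one>\<^bsub>Diff_circle\<^esub>" by (simp add: rotation_0 Diff_circle_def)
      then show ?case by (simp add: generate.one)
    next
      case (Suc i)
      have "rotation (1 / real n) \<otimes>\<^bsub>Diff_circle\<^esub> rotation (real i / real n)
          \<in> generate Diff_circle {rotation (1 / real n)}"
        using Suc by (intro generate.eng[OF generate.incl]) auto
      then show ?case by (simp add: Diff_circle_def rotation_comp add_divide_distrib)
    qed
  qed
  then show ?thesis
    unfolding range by (simp add: subgroup_generated_def rotation_in_Diff_circle)
qed

text \<open>Angles in the interval from 0 to 1, without 1, that differ by an integer are
  equal.\<close>

lemma card_rotations:
  assumes "n > 0"
  shows "card ((\<lambda>j. rotation (real j / real n)) ` {..<n}) = n"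
proof -
  have "inj_on (\<lambda>j. rotation (real j / real n)) {..<n}"
  proof (rule inj_onI)
    fix i j assume ij: "i \<in> {..<n}" "j \<in> {..<n}" "rotation (real i / real n) = rotation (real j / real n)"
    then have "real i / real n - real j / real n \<in> \<int>" by (simp add: rotation_eq_iff)
    then have "real i / real n - real j / real n = 0"
      using ij Ints_nonzero_abs_less1[of "real i / real n - real j / real n"] assms
      by (simp add: abs_if field_simps split: if_splits)
    then show "i = j" using assms by (simp add: field_simps)
  qed
  then show ?thesis by (simp add: card_image)
qed

text \<open>Left translation is injective, undone by the opposite rotation, hence bijective on a
  finite set; right translation agrees with it because rotations commute.\<close>

lemma cyclic_cycles_rotation:
  assumes "n > 0"
  shows "cyclic_cycles (subgroup_generated Diff_circle {rotation (1 / real n)}) (rotation (1 / real n))"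
    (is "cyclic_cycles ?H ?r")
proof
  have mult: "g \<otimes>\<^bsub>?H\<^esub> h = g \<circ> h" for g h by (simp add: Diff_circle_def)
  show fin: "finite (carrier ?H)" by (simp add: carrier_generated_rotation[OF assms])
  have "rotation (1 / real n) \<in> generate Diff_circle {rotation (1 / real n)}"
    by (rule generate.incl) simp
  then show r: "?r \<in> carrier ?H"
    by (simp add: subgroup_generated_def rotation_in_Diff_circle)
  have rot: "\<exists>t. g = rotation t" if "g \<in> carrier ?H" for g
    using that by (auto simp: carrier_generated_rotation[OF assms])
  have closed: "?r \<circ> g \<in> carrier ?H" if "g \<in> carrier ?H" for g
    using that r generate.eng[of _ Diff_circle]
    by (simp add: subgroup_generated_def Diff_circle_def)
  have comm: "g \<circ> ?r = ?r \<circ> g" if "g \<in> carrier ?H" for g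
    using rot[OF that] by (auto simp: rotation_comp add.commute)
  have "inj_on (\<lambda>g. ?r \<circ> g) (carrier ?H)"
  proof (rule inj_onI)
    fix g h assume "?r \<circ> g = ?r \<circ> h"
    then have "rotation (- (1 / real n)) \<circ> (?r \<circ> g) = rotation (- (1 / real n)) \<circ> (?r \<circ> h)" by simp
    then show "g = h" by (simp add: comp_assoc[symmetric] rotation_comp rotation_0)
  qed
  moreover have "(\<lambda>g. ?r \<circ> g) ` carrier ?H \<subseteq> carrier ?H" using closed by auto
  ultimately have bij: "bij_betw (\<lambda>g. ?r \<circ> g) (carrier ?H) (carrier ?H)"
    using endo_inj_surj[OF fin] by (simp add: bij_betw_def)
  then show "bij_betw (\<lambda>j. ?r \<otimes>\<^bsub>?H\<^esub> j) (carrier ?H) (carrier ?H)" by (simp only: mult)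
  show "bij_betw (\<lambda>j. j \<otimes>\<^bsub>?H\<^esub> ?r) (carrier ?H) (carrier ?H)"
    using bij by (subst bij_betw_cong[where g = "\<lambda>g. ?r \<circ> g"]) (simp_all only: mult comm)
qed

text \<open>Since \<open>g \<mapsto> r \<circ> g\<close> permutes the subgroup, only
  \<open>n\<close> times the angle \<open>1 / n + m\<close> of the lift of \<open>r\<close>
  survives. The integer \<open>m\<close> depends on the chosen section, hence a congruence.\<close>

lemma sum_extension_cocycle_rotation:
  assumes "n > 0"
  shows "[\<Sum>g\<in>carrier (subgroup_generated Diff_circle {rotation (1 / real n)}).
      extension_cocycle Diff_line_periodic Diff_circle translation descend [rotation (1 / real n), g] = 1]
    (mod int n)"
    (is "[(\<Sum>g\<in>carrier ?H. ?e [?r, g]) = 1] (mod _)")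
proof -
  interpret cyclic_cycles ?H ?r by (rule cyclic_cycles_rotation[OF assms])
  have mult: "g \<otimes>\<^bsub>?H\<^esub> h = g \<circ> h" for g h by (simp add: Diff_circle_def)
  have card: "card (carrier ?H) = n"
    by (simp add: carrier_generated_rotation[OF assms] card_rotations[OF assms])
  obtain m :: int where m: "rotation_lift ?r - 1 / real n = of_int m"
    using section_rotation(2)[of "1 / real n"] by (auto elim: Ints_cases)
  have "of_int (?e [?r, g]) = rotation_lift ?r + rotation_lift g - rotation_lift (?r \<circ> g)"
    if "g \<in> carrier ?H" for g
    using that extension_cocycle_rotation by (auto simp: carrier_generated_rotation[OF assms])
  then have "of_int (\<Sum>g\<in>carrier ?H. ?e [?r, g])
      = (\<Sum>g\<in>carrier ?H. rotation_lift ?r + rotation_lift g - rotation_lift (?r \<circ> g))"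
    by simp
  also have "\<dots> = real n * rotation_lift ?r + (\<Sum>g\<in>carrier ?H. rotation_lift g)
      - (\<Sum>g\<in>carrier ?H. rotation_lift (?r \<circ> g))"
    by (simp add: sum.distrib sum_subtractf card)
  also have "(\<Sum>g\<in>carrier ?H. rotation_lift (?r \<circ> g)) = (\<Sum>g\<in>carrier ?H. rotation_lift g)"
    using bij_left unfolding mult by (rule sum.reindex_bij_betw)
  finally have "of_int (\<Sum>g\<in>carrier ?H. ?e [?r, g]) = real n * rotation_lift ?r" by simp
  also have "rotation_lift ?r = 1 / real n + of_int m" using m by simp
  also have "real n * (1 / real n + of_int m) = of_int (1 + int n * m)"
    using assms by (simp add: field_simps)
  finally have "(\<Sum>g\<in>carrier ?H. ?e [?r, g]) = 1 + int n * m" using of_int_eq_iff by blast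
  then show ?thesis by (simp add: cong_def)
qed

theorem corollary1p16:
  fixes n k :: nat
  assumes "n \<ge> 2" and "k > 0"
    and "\<forall>X \<in> carrier (group_homology (subgroup_generated Diff_circle {rotation (1 / real n)}) (2 * k - 1)).
           group_homology_induced Diff_circle id (2 * k - 1) X = \<one>\<^bsub>group_homology Diff_circle (2 * k - 1)\<^esub>"
  shows "cup_power Diff_circle 2 euler_class k \<noteq> \<one>\<^bsub>group_cohomology Diff_circle (2 * k)\<^esub>"
proof
  assume zero: "cup_power Diff_circle 2 euler_class k = \<one>\<^bsub>group_cohomology Diff_circle (2 * k)\<^esub>"
  let ?H = "subgroup_generated Diff_circle {rotation (1 / real n)}"
  let ?e = "extension_cocycle Diff_line_periodic Diff_circle translation descend"
  let ?N = "\<Sum>g\<in>carrier ?H. ?e [rotation (1 / real n), g]"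
  have n: "n > 0" using assms(1) by simp
  have "int (card (carrier ?H)) dvd ?N ^ k"
  proof (rule cup_power_eq_one_imp_dvd)
    show "cyclic_cycles ?H (rotation (1 / real n))" by (rule cyclic_cycles_rotation[OF n])
    show "carrier ?H \<subseteq> carrier Diff_circle"
      by (auto simp: carrier_generated_rotation[OF n] rotation_in_Diff_circle)
    show "(\<lambda>gs. of_int (?e gs)) \<in> euler_class"
      unfolding euler_class_def extension_class_def by (rule mem_cohomology_class)
  qed (use assms zero in simp_all)
  then have "int n dvd ?N ^ k"
    by (simp add: carrier_generated_rotation[OF n] card_rotations[OF n])
  moreover have "[?N ^ k = 1 ^ k] (mod int n)"
    by (intro cong_pow sum_extension_cocycle_rotation[OF n])
  ultimately have "int n dvd 1" by (simp add: cong_dvd_iff)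
  with assms(1) show False by simp
qed

end
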